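(* Let $p$ be an odd prime, let $s$ be the multiplicative order of $2$ in $\mathbb{F}_p^\times$, and let $\mathbf{M}=\prod_{m=0}^{s-1}(\mathbf{I}-\mathbf{T}^{2^m})$, where $\mathbf{T}$ is the $p\times p$ cyclic permutation matrix defined in the context. Let $\lambda$ be an eigenvalue of $\mathbf{M}$ of maximal modulus and let $r\in\{1,2,4\}$ be the smallest positive integer such that $\lambda^r$ is real and positive. Then $r\neq 2$.
   Context: $\mathbf{I}$ is the $p\times p$ identity matrix and $\mathbf{T}$ is the $p\times p$ matrix with entries $1$ on the subdiagonal (positions $(i+1,i)$, $1\le i\le p-1$) and in the upper right corner (position $(1,p)$), and all other entries $0$. It is a known fact that such an $r\in\{1,2,4\}$ exists. *)

theory Defs
  imports "HOL-Number_Theory.Number_Theory" "Jordan_Normal_Form.Char_Poly"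
begin

(* Rows and columns are indexed from 0, so the upper right corner is (0, p - 1). *)
definition cyclic_perm_mat :: "nat \<Rightarrow> 'a :: {zero, one} mat" where
  "cyclic_perm_mat p =
     mat p p (\<lambda>(i, j). if i = j + 1 \<or> (i = 0 \<and> j = p - 1) then 1 else 0)"

(* Matrices of unspecified dimension do not form a monoid type class, so the product over
   m = 0, ..., s - 1 is written as a fold; the factors are taken from left to right. *)
definition mat_M :: "nat \<Rightarrow> nat \<Rightarrow> 'a :: ring_1 mat" where
  "mat_M p s =
     foldr (*) (map (\<lambda>m. 1\<^sub>m p - cyclic_perm_mat p ^\<^sub>m (2 ^ m)) [0..<s]) (1\<^sub>m p)"

end

theory Submission
  imports Defs
begin

text \<open>
  Reading a vector \<open>v\<close> as the polynomial \<open>q\<^sub>v(x) = \<Sum> v\<^sub>i x\<^sup>i\<close>, the cyclic matrix acts as multiplication by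
  \<open>x\<close> at every \<open>p\<close>-th root of unity \<open>z\<close>. As \<open>q\<^sub>v\<close> cannot vanish at all \<open>p\<close> of them, every eigenvalue of
  the product has the form \<open>\<lambda>\<^sub>z = \<Prod> (1 - z ^ 2 ^ m)\<close>. If \<open>s\<close> is even, then \<open>2 ^ (s div 2)\<close> is \<open>-1\<close>
  modulo \<open>p\<close>, the factors form conjugate pairs, and \<open>\<lambda>\<^sub>z \<ge> 0\<close>. If \<open>s\<close> is odd, then
  \<open>1 - 1 / w = - (1 - w) / w\<close> and \<open>\<Sum> 2 ^ m = 2 ^ s - 1\<close> being divisible by \<open>p\<close> show that the conjugate of
  \<open>\<lambda>\<^sub>z\<close> is \<open>- \<lambda>\<^sub>z\<close>, so its square is not positive.
\<close>

section \<open>Evaluation of vectors at roots of unity\<close>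

definition vec_eval :: "'a :: comm_ring_1 \<Rightarrow> 'a vec \<Rightarrow> 'a" where
  "vec_eval z v = (\<Sum>i<dim_vec v. v $ i * z ^ i)"

lemma vec_eval_smult: "vec_eval z (c \<cdot>\<^sub>v v) = c * vec_eval z v"
  by (simp add: vec_eval_def sum_distrib_left mult.assoc)

lemma vec_eval_diff:
  assumes "v \<in> carrier_vec n" "w \<in> carrier_vec n"
  shows "vec_eval z (v - w) = vec_eval z v - vec_eval z w"
  using assms by (simp add: vec_eval_def sum_subtractf algebra_simps)

lemma cyclic_perm_mat_carrier [simp]: "cyclic_perm_mat p \<in> carrier_mat p p"
  by (simp add: cyclic_perm_mat_def)

lemma cyclic_perm_mat_mult_vec_index:
  fixes v :: "'a :: comm_ring_1 vec"
  assumes v: "v \<in> carrier_vec p" and i: "i < p"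
  shows "(cyclic_perm_mat p *\<^sub>v v) $ i = v $ (if i = 0 then p - 1 else i - 1)"
proof -
  \<comment> \<open>Row \<open>i\<close> has its only 1 in column \<open>k\<close>; row 0 takes it
    from the corner entry.\<close>
  define k where "k = (if i = 0 then p - 1 else i - 1)"
  have k: "k < p" using i by (auto simp: k_def)
  have "(cyclic_perm_mat p *\<^sub>v v) $ i
      = (\<Sum>j<p. (if i = j + 1 \<or> (i = 0 \<and> j = p - 1) then 1 else 0) * v $ j)"
    using v i by (auto simp: cyclic_perm_mat_def scalar_prod_def lessThan_atLeast0)
  also have "\<dots> = (\<Sum>j<p. if j = k then v $ j else 0)"
    using i by (intro sum.cong) (auto simp: k_def)
  also have "\<dots> = v $ k" using k by simp
  finally show ?thesis by (simp add: k_def)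
qed

text \<open>The matrix raises every exponent by one, except that the top coefficient wraps around to
  exponent 0; \<open>z ^ p = 1\<close> makes up for the wrap.\<close>

lemma vec_eval_cyclic_perm_mat:
  assumes v: "v \<in> carrier_vec p" and z: "z ^ p = 1"
  shows "vec_eval z (cyclic_perm_mat p *\<^sub>v v) = z * vec_eval z v"
proof (cases p)
  case 0
  then show ?thesis using v by (simp add: vec_eval_def cyclic_perm_mat_def)
next
  case (Suc n)
  have dim: "dim_vec (cyclic_perm_mat p *\<^sub>v v) = p" by (simp add: cyclic_perm_mat_def)
  have "vec_eval z (cyclic_perm_mat p *\<^sub>v v)
      = (\<Sum>i<Suc n. v $ (if i = 0 then p - 1 else i - 1) * z ^ i)"
    unfolding vec_eval_def dim Suc[symmetric]
    by (intro sum.cong) (simp_all add: cyclic_perm_mat_mult_vec_index[OF v])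
  also have "\<dots> = v $ n * z ^ Suc n + (\<Sum>i<n. v $ i * z ^ Suc i)"
    using z Suc by (simp only: sum.lessThan_Suc_shift) simp
  also have "\<dots> = z * vec_eval z v"
    using v Suc by (simp add: vec_eval_def sum_distrib_left algebra_simps)
  finally show ?thesis .
qed

lemma vec_eval_cyclic_perm_mat_pow:
  assumes "v \<in> carrier_vec p" and "z ^ p = 1"
  shows "vec_eval z (cyclic_perm_mat p ^\<^sub>m n *\<^sub>v v) = z ^ n * vec_eval z v"
  using assms(1)
proof (induction n arbitrary: v)
  case 0
  then show ?case by (simp add: cyclic_perm_mat_def)
next
  case (Suc n)
  \<comment> \<open>The matrix power unfolds with its new factor on the right, so the induction
    hypothesis is needed at the shifted vector; hence \<open>v\<close> is arbitrary.\<close>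
  have "cyclic_perm_mat p ^\<^sub>m Suc n *\<^sub>v v
      = cyclic_perm_mat p ^\<^sub>m n *\<^sub>v (cyclic_perm_mat p *\<^sub>v v)"
    using Suc.prems by (simp add: assoc_mult_mat_vec[of _ p p _ p])
  then show ?case
    using Suc.IH[of "cyclic_perm_mat p *\<^sub>v v"] vec_eval_cyclic_perm_mat[OF Suc.prems assms(2)]
      Suc.prems by (simp add: mult_mat_vec_carrier[of _ p p] mult.assoc mult.commute)
qed

text \<open>The row vector of the powers of \<open>z\<close> is a common left eigenvector of all
  factors, so each factor peels off as a scalar.\<close>

lemma vec_eval_mat_M:
  fixes v :: "'a :: comm_ring_1 vec"
  assumes v: "v \<in> carrier_vec p" and z: "z ^ p = 1"
  shows "vec_eval z (mat_M p s *\<^sub>v v) = (\<Prod>m<s. 1 - z ^ 2 ^ m) * vec_eval z v"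
proof -
  define F :: "nat \<Rightarrow> 'a mat" where "F m = 1\<^sub>m p - cyclic_perm_mat p ^\<^sub>m (2 ^ m)" for m
  have F: "F m \<in> carrier_mat p p" for m by (simp add: F_def pow_carrier_mat minus_carrier_mat)
  have prod_carrier: "foldr (*) (map F ms) (1\<^sub>m p) \<in> carrier_mat p p" for ms
    by (induction ms) (auto intro: mult_carrier_mat F)
  have eval_F: "vec_eval z (F m *\<^sub>v w) = (1 - z ^ 2 ^ m) * vec_eval z w"
    if w: "w \<in> carrier_vec p" for m w
  proof -
    have "F m *\<^sub>v w = w - cyclic_perm_mat p ^\<^sub>m (2 ^ m) *\<^sub>v w"
      unfolding F_def using w
      by (simp add: minus_mult_distrib_mat_vec[of _ p p] pow_carrier_mat)
    moreover have "cyclic_perm_mat p ^\<^sub>m (2 ^ m) *\<^sub>v w \<in> carrier_vec p"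
      using w by (simp add: mult_mat_vec_carrier[of _ p p] pow_carrier_mat)
    ultimately show ?thesis
      using w z by (simp add: vec_eval_diff vec_eval_cyclic_perm_mat_pow left_diff_distrib)
  qed
  have "vec_eval z (foldr (*) (map F ms) (1\<^sub>m p) *\<^sub>v v)
      = (\<Prod>m\<leftarrow>ms. 1 - z ^ 2 ^ m) * vec_eval z v" for ms
  proof (induction ms)
    case Nil
    then show ?case using v by simp
  next
    case (Cons m ms)
    have "foldr (*) (map F (m # ms)) (1\<^sub>m p) *\<^sub>v v
        = F m *\<^sub>v (foldr (*) (map F ms) (1\<^sub>m p) *\<^sub>v v)"
      using v by (simp add: assoc_mult_mat_vec[OF F prod_carrier])
    then show ?case
      using Cons.IH eval_F mult_mat_vec_carrier[OF prod_carrier v] by (simp add: mult.assoc)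
  qed
  from this[of "[0..<s]"] show ?thesis
    by (simp add: mat_M_def F_def[abs_def] prod.distinct_set_conv_list[symmetric] lessThan_atLeast0)
qed

section \<open>Eigenvalues of the product matrix\<close>

lemma mat_M_carrier: "(mat_M p s :: 'a :: ring_1 mat) \<in> carrier_mat p p"
proof -
  have "foldr (*) (map (\<lambda>m. 1\<^sub>m p - cyclic_perm_mat p ^\<^sub>m (2 ^ m)) ms) (1\<^sub>m p :: 'a mat)
      \<in> carrier_mat p p" for ms :: "nat list"
    by (induction ms) (auto intro!: mult_carrier_mat minus_carrier_mat pow_carrier_mat)
  then show ?thesis by (simp add: mat_M_def)
qed

text \<open>The entries are the coefficients of a polynomial of degree below \<open>p\<close>, and
  it has \<open>p\<close> distinct roots.\<close>

lemma vec_eq_0_if_vec_eval_roots_unity: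
  fixes v :: "complex vec"
  assumes v: "v \<in> carrier_vec p" and p: "p > 0"
    and zero: "\<And>z. z ^ p = 1 \<Longrightarrow> vec_eval z v = 0"
  shows "v = 0\<^sub>v p"
proof -
  define q where "q = (\<Sum>i<p. monom (v $ i) i)"
  have coeff_q: "coeff q i = (if i < p then v $ i else 0)" for i
    by (simp add: q_def coeff_sum)
  have "degree q \<le> p - 1" by (rule degree_le) (auto simp: coeff_q)
  then have "degree q < p" using p by simp
  moreover have "card {z::complex. z ^ p = 1} = p" using p by (rule card_roots_unity_eq)
  moreover have "poly q z = poly 0 z" if "z \<in> {z. z ^ p = 1}" for z
    using that zero[of z] v by (simp add: q_def poly_sum poly_monom vec_eval_def)
  ultimately have "q = 0" using p by (intro poly_eqI_degree[of "{z. z ^ p = 1}"]) auto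
  then show ?thesis using v coeff_q by (intro eq_vecI) (metis carrier_vecD coeff_0 index_zero_vec, simp)
qed

lemma eigenvalue_mat_M:
  fixes lam :: complex
  assumes p: "p > 0" and ev: "eigenvalue (mat_M p s) lam"
  obtains z where "z ^ p = 1" and "lam = (\<Prod>m<s. 1 - z ^ 2 ^ m)"
proof -
  from ev obtain v where v: "v \<in> carrier_vec p" "v \<noteq> 0\<^sub>v p" "mat_M p s *\<^sub>v v = lam \<cdot>\<^sub>v v"
    using mat_M_carrier[of p s, where 'a = complex]
    by (auto simp: eigenvalue_def eigenvector_def)
  with p obtain z where z: "z ^ p = 1" "vec_eval z v \<noteq> 0"
    using vec_eq_0_if_vec_eval_roots_unity by blast
  have "lam * vec_eval z v = (\<Prod>m<s. 1 - z ^ 2 ^ m) * vec_eval z v"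
    using vec_eval_mat_M[OF v(1) z(1), of s] v(3) by (simp add: vec_eval_smult)
  with z that show thesis by simp
qed

section \<open>The products of \<open>1 - z ^ 2 ^ m\<close> at roots of unity\<close>

lemma prod_lessThan_double:
  fixes f :: "nat \<Rightarrow> 'a :: comm_monoid_mult"
  shows "(\<Prod>m<2 * h. f m) = (\<Prod>m<h. f m * f (m + h))"
proof -
  have "(\<Prod>m<2 * h. f m) = (\<Prod>m<h. f m) * (\<Prod>m=h..<h + h. f m)"
    by (simp add: lessThan_atLeast0 prod.atLeastLessThan_concat mult_2)
  also have "(\<Prod>m=h..<h + h. f m) = (\<Prod>m<h. f (m + h))"
    using prod.shift_bounds_nat_ivl[of f 0 h h] by (simp add: lessThan_atLeast0)
  finally show ?thesis by (simp add: prod.distrib)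
qed

text \<open>The prime divides \<open>2 ^ (2 * h) - 1 = (2 ^ h + 1) * (2 ^ h - 1)\<close>, and
  minimality of the order rules out the second factor.\<close>

lemma prime_dvd_two_power_half_ord:
  fixes p :: nat
  assumes "prime p" and "ord p 2 = 2 * h" and "h > 0"
  shows "p dvd 2 ^ h + 1"
proof -
  have "p dvd (2::nat) ^ (2 * h) - 1"
    using ord[of 2 p] assms(2) by (metis cong_to_1_nat)
  also have "(2::nat) ^ (2 * h) - 1 = (2 ^ h + 1) * (2 ^ h - 1)"
    by (simp add: power_add[symmetric] mult_2_right algebra_simps)
  finally have "p dvd 2 ^ h + 1 \<or> p dvd (2::nat) ^ h - 1"
    using assms(1) by (simp only: prime_dvd_mult_iff)
  moreover have "\<not> p dvd (2::nat) ^ h - 1"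
  proof
    assume "p dvd (2::nat) ^ h - 1"
    then have "[2 ^ h = 1] (mod p)" by (subst cong_altdef_nat) simp_all
    then have "ord p 2 dvd h" by (simp only: ord_divides)
    then show False using assms(2,3) by (auto dest: dvd_imp_le)
  qed
  ultimately show ?thesis by blast
qed

lemma root_unity_power_eq_1:
  fixes z :: "'a :: monoid_mult"
  assumes "z ^ p = 1" and "p dvd n"
  shows "z ^ n = 1"
  using assms by (auto simp: power_mult)

lemma cnj_root_unity:
  assumes "z ^ p = 1" and "p > 0"
  shows "cnj z * z = 1"
proof -
  have "cmod z = 1" using power_eq_1_iff[OF assms(1)] assms(2) by simp
  then show ?thesis using complex_norm_square[of z] by (simp add: mult.commute)
qed

text \<open>Both \<open>z ^ 2 ^ h\<close> and \<open>cnj z\<close> are inverse to \<open>z\<close>,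
  so the factors at \<open>m\<close> and \<open>m + h\<close> are conjugate and each pair multiplies
  to a squared modulus.\<close>

lemma two_power_prod_nonneg:
  fixes z :: complex
  assumes "z ^ p = 1" and "p > 0" and "p dvd 2 ^ h + 1"
  shows "\<exists>x\<ge>0. (\<Prod>m<2 * h. 1 - z ^ 2 ^ m) = complex_of_real x"
proof -
  have "z ^ 2 ^ h * z = 1"
    using root_unity_power_eq_1[OF assms(1,3)] by (simp add: mult.commute)
  then have "z ^ 2 ^ h = cnj z"
    using cnj_root_unity[OF assms(1,2)] by (metis mult_cancel_right mult_zero_right zero_neq_one)
  then have "z ^ 2 ^ (m + h) = cnj z ^ 2 ^ m" for m
    by (simp add: power_add mult.commute[of "2 ^ m"] power_mult)
  then have "(1 - z ^ 2 ^ m) * (1 - z ^ 2 ^ (m + h)) = of_real ((cmod (1 - z ^ 2 ^ m))\<^sup>2)" for m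
    using complex_norm_square[of "1 - z ^ 2 ^ m"] by simp
  then have "(\<Prod>m<2 * h. 1 - z ^ 2 ^ m) = of_real (\<Prod>m<h. (cmod (1 - z ^ 2 ^ m))\<^sup>2)"
    by (simp only: prod_lessThan_double of_real_prod)
  then show ?thesis by (intro exI[of _ "\<Prod>m<h. (cmod (1 - z ^ 2 ^ m))\<^sup>2"]) (simp add: prod_nonneg)
qed

lemma cnj_two_power_prod:
  fixes z :: complex
  assumes "z ^ p = 1" and "p > 0" and "p dvd 2 ^ s - 1"
  shows "cnj (\<Prod>m<s. 1 - z ^ 2 ^ m) = (- 1) ^ s * (\<Prod>m<s. 1 - z ^ 2 ^ m)"
proof -
  have "(\<Sum>m<s. 2 ^ m) = (2::nat) ^ s - 1"
    by (induction s) auto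
  then have "(\<Prod>m<s. z ^ 2 ^ m) = 1"
    using root_unity_power_eq_1[OF assms(1,3)] by (simp add: power_sum[symmetric])
  then have prod_cnj: "(\<Prod>m<s. cnj z ^ 2 ^ m) = 1"
    by (metis (no_types, lifting) cnj_prod complex_cnj_one complex_cnj_power prod.cong)
  \<comment> \<open>With \<open>w = z ^ 2 ^ m\<close> on the unit circle,
    \<open>cnj w * w = 1\<close>; the factors \<open>cnj w\<close> pulled out here multiply to 1 by
    \<open>prod_cnj\<close>.\<close>
  have "1 - cnj z ^ 2 ^ m = - 1 * (cnj z ^ 2 ^ m * (1 - z ^ 2 ^ m))" for m
    using cnj_root_unity[OF assms(1,2)]
    by (simp add: right_diff_distrib power_mult_distrib[symmetric])
  then have "cnj (\<Prod>m<s. 1 - z ^ 2 ^ m) = (\<Prod>m<s. - 1 * (cnj z ^ 2 ^ m * (1 - z ^ 2 ^ m)))"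
    by simp
  also have "\<dots> = (- 1) ^ s * ((\<Prod>m<s. cnj z ^ 2 ^ m) * (\<Prod>m<s. 1 - z ^ 2 ^ m))"
    by (simp only: prod.distrib prod_constant card_lessThan)
  finally show ?thesis by (simp only: prod_cnj mult_1)
qed

theorem mainTheorem4:
  fixes p s r :: nat and M :: "complex mat" and lam :: complex
  assumes "prime p" and "odd p"
    and "s = ord p 2"
    and "M = mat_M p s"
    and "eigenvalue M lam"
    and "\<And>\<mu>. eigenvalue M \<mu> \<Longrightarrow> cmod \<mu> \<le> cmod lam"
    and "r \<in> {1, 2, 4}"
    and "lam ^ r \<in> \<real>" and "Re (lam ^ r) > 0"
    and "\<And>k. 0 < k \<Longrightarrow> k < r \<Longrightarrow> \<not> (lam ^ k \<in> \<real> \<and> Re (lam ^ k) > 0)"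
  shows "r \<noteq> 2"
proof
  assume r: "r = 2"
  have p: "p > 0" using assms(1) by (rule prime_gt_0_nat)
  obtain z where z: "z ^ p = 1" and lam: "lam = (\<Prod>m<s. 1 - z ^ 2 ^ m)"
    using eigenvalue_mat_M[OF p] assms(4,5) by blast
  \<comment> \<open>Coprimality makes the order positive, which excludes \<open>h = 0\<close> in the
    even case.\<close>
  have "coprime p 2" using assms(2) by simp
  then have s: "s > 0" by (simp add: assms(3) ord_eq_0)
  show False
  proof (cases "even s")
    case True
    then obtain h where h: "s = 2 * h" by blast
    then obtain x where x: "x \<ge> 0" "lam = complex_of_real x"
      using two_power_prod_nonneg[OF z p, of h] prime_dvd_two_power_half_ord[OF assms(1), of h]
        assms(3) s lam by auto
    moreover have "x \<noteq> 0" using assms(9) x r by auto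
    \<comment> \<open>Now \<open>lam\<close> itself is real and positive, so the exponent 1
      contradicts the minimality of \<open>r\<close>.\<close>
    ultimately show False using assms(10)[of 1] r by simp
  next
    case False
    have "p dvd 2 ^ s - 1"
      using ord[of 2 p] assms(3) by (metis cong_to_1_nat)
    from cnj_two_power_prod[OF z p this] have "cnj lam = - lam"
      using False by (simp add: lam)
    \<comment> \<open>A purely imaginary \<open>lam\<close> has the square
      \<open>- (Im lam)^2\<close>, which is never positive.\<close>
    then have "Re lam = 0" by (simp add: complex_eq_iff)
    then show False using assms(9) r by (simp add: power2_eq_square)
  qed
qed

end
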